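(* Let $k>1$ be an integer. If $2k-1$ has a (positive) divisor $d$ with $d\equiv \pm 3 \pmod{8}$, then the equation $x^2+(2k-1)^y=k^z$ has no solutions in positive integers $x,y,z$ with $y\in\{3,5\}$. *)

theory Defs
  imports Complex_Main "HOL-Number_Theory.Number_Theory"
begin

end

(* Modulo d the equation makes 2 a square if z is odd, which is impossible for d = 3, 5 (mod 8);
   so z = 2w. The coprime factors k^w - x and k^w + x of (2k-1)^y are then y-th powers a^y < b^y
   with ab = 2k-1 and a^y + b^y = 2k^w. If a = 1, reduction modulo k^2 gives k = y. If a >= 3,
   then b < k forces w < y, and size leaves the curves (ab+1)^w = 2^(w-1) (a^y + b^y) with
   (y,w) = (3,2), (5,3), (5,4). On each of them Runge's method applies: an integer polynomial in
   a and b is nonzero, but tends to 0 along the branch of the curve on which b > a is large. *)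
theory Submission
  imports Defs "HOL-Computational_Algebra.Nth_Powers"
begin

section \<open>The quadratic character of 2 modulo d\<close>

text \<open>Descent: for an odd root v < d, the cofactor of d in v^2 - 2 is again 3 or 5 modulo 8.\<close>

lemma two_not_square_mod:
  fixes d y :: int
  assumes "d > 0" "[d = 3] (mod 8) \<or> [d = -3] (mod 8)"
  shows "\<not> d dvd y\<^sup>2 - 2"
  using assms
proof (induction "nat d" arbitrary: d y rule: less_induct)
  case less
  have d8: "d mod 8 = 3 \<or> d mod 8 = 5"
    using less.prems(2) by (auto simp: cong_def)
  show ?case
  proof
    assume dvd: "d dvd y\<^sup>2 - 2"
    define r where "r = y mod d"
    \<comment> \<open>As \<open>d\<close> is odd, one of \<open>r\<close> and \<open>d - r\<close>
      is odd. Oddness puts \<open>v^2 - 2\<close> in the class 7 modulo 8, and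
      \<open>v \<le> d\<close> makes its cofactor smaller than \<open>d\<close>.\<close>
    define v where "v = (if odd r then r else d - r)"
    have r: "0 \<le> r" "r < d" using less.prems(1) by (auto simp: r_def)
    have "odd d" using d8 by presburger
    then have v: "odd v" "0 < v" "v \<le> d"
      using r by (auto simp: v_def intro: Nat.gr0I)
        (metis even_zero le_less)
    have "d dvd y - r" by (simp add: r_def mod_eq_dvd_iff[symmetric])
    have "d dvd y\<^sup>2 - v\<^sup>2"
    proof -
      have "y\<^sup>2 - v\<^sup>2 = (y - v) * (y + v)" by (simp add: power2_eq_square algebra_simps)
      moreover have "d dvd y - v \<or> d dvd y + v"
        using \<open>d dvd y - r\<close> dvd_add[OF \<open>d dvd y - r\<close> dvd_refl]
        by (auto simp: v_def algebra_simps)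
      ultimately show ?thesis by auto
    qed
    then have "d dvd v\<^sup>2 - 2"
      using dvd_diff[OF dvd] by fastforce
    then obtain m where m: "v\<^sup>2 - 2 = d * m" by (elim dvdE)
    have "v\<^sup>2 mod 8 = 1"
    proof -
      have "v mod 8 = 1 \<or> v mod 8 = 3 \<or> v mod 8 = 5 \<or> v mod 8 = 7" using v(1) by presburger
      then show ?thesis by (auto simp: power_mod[of v 8 2, symmetric])
    qed
    then have dm8: "(d * m) mod 8 = 7" unfolding m[symmetric] by presburger
    \<comment> \<open>Since 3 * 5 is 7 modulo 8, passing from \<open>d\<close> to \<open>m\<close>
      interchanges the residues 3 and 5.\<close>
    have m8: "m mod 8 = 3 \<or> m mod 8 = 5"
    proof -
      have "((d mod 8) * (m mod 8)) mod 8 = 7" using dm8 by (simp add: mod_mult_eq)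
      moreover have "m mod 8 \<in> {0,1,2,3,4,5,6,7}" by auto
      ultimately show ?thesis using d8 by auto
    qed
    have "v \<noteq> 1"
    proof
      assume "v = 1"
      then have "d * (- m) = 1" using m by simp
      then have "d dvd 1" by (metis dvd_triv_left)
      then show False using d8 less.prems(1) by simp
    qed
    then have "v \<ge> 3" using v(1,2) by presburger
    then have "v\<^sup>2 \<ge> 3\<^sup>2" by (intro power_mono) auto
    then have "d * m > 0" using m by simp
    then have "m > 0" using less.prems(1) by (simp add: zero_less_mult_iff)
    have "v\<^sup>2 \<le> d\<^sup>2" using v by (intro power_mono) auto
    then have "d * m < d * d" using m by (simp add: power2_eq_square)
    then have "m < d" using less.prems(1) by simp
    have "m dvd v\<^sup>2 - 2" using m by simp
    moreover have "[m = 3] (mod 8) \<or> [m = -3] (mod 8)" using m8 by (auto simp: cong_def)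
    ultimately show False using less.hyps[of m v] \<open>m < d\<close> \<open>m > 0\<close> by simp
  qed
qed

section \<open>Coprime factors of a perfect power\<close>

lemma coprime_mult_eq_powerE_int:
  fixes u v p :: int
  assumes "coprime u v" "u > 0" "v > 0" "p > 0" "n > 0" "u * v = p ^ n"
  obtains a b where "a > 0" "b > 0" "u = a ^ n" "v = b ^ n" "a * b = p"
proof -
  have "nat u * nat v = nat p ^ n"
    using assms by (metis nat_mult_distrib nat_power_eq less_imp_le)
  then have "is_nth_power n (nat u * nat v)" by (auto simp: is_nth_power_def)
  moreover have "coprime (nat u) (nat v)"
    using assms by (simp add: coprime_int_iff[symmetric])
  ultimately have "is_nth_power n (nat u)" "is_nth_power n (nat v)"
    using is_nth_power_mult_coprime_natD[of "nat u" "nat v" n] assms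
    by (auto simp: coprime_commute mult.commute)
  then obtain a b where ab: "nat u = a ^ n" "nat v = b ^ n"
    by (auto simp: is_nth_power_def)
  have u: "u = int a ^ n" and v: "v = int b ^ n"
    using ab assms(2,3) by (metis int_nat_eq less_imp_le of_nat_power)+
  have pos: "int a > 0" "int b > 0"
    using u v assms(2,3,5) by (cases a; cases b; simp add: zero_power)+
  have "(int a * int b) ^ n = p ^ n" using u v assms(6) by (simp add: power_mult_distrib)
  then have "int a * int b = p"
    using pos assms(4,5) by (metis less_imp_le mult_nonneg_nonneg power_eq_imp_eq_base)
  with that pos u v show thesis by blast
qed

section \<open>The three exceptional curves\<close>

text \<open>The branch is \<open>a^2 ~ 2 * b\<close>, and \<open>h\<close> measures the distance
  from it. Size forces the odd number \<open>h\<close> to be -1, and then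
  \<open>a^2 = 2 * b + 1\<close> fails modulo 4.\<close>

lemma cubes_sum_ne_square:
  fixes a b :: int
  assumes "odd a" "odd b" "3 \<le> a" "a < b"
  shows "(a * b + 1)\<^sup>2 \<noteq> 2 * (a ^ 3 + b ^ 3)"
proof
  assume eq: "(a * b + 1)\<^sup>2 = 2 * (a ^ 3 + b ^ 3)"
  define h where "h = 2 * b - a\<^sup>2"
  have h: "h * b\<^sup>2 = 2 * a * b + 1 - 2 * a ^ 3"
    using eq unfolding h_def by (simp add: eval_nat_numeral algebra_simps)
  have "odd h" using assms by (simp add: h_def)
  then have "h \<ge> 1 \<or> h \<le> -1" by presburger
  then consider "h \<ge> 1" | "h \<le> -1" by blast
  then show False
  proof cases
    case 1
    have "b\<^sup>2 \<le> h * b\<^sup>2" using 1 by (simp add: mult_le_cancel_right1)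
    then have "(b - a)\<^sup>2 + a\<^sup>2 * (2 * a - 1) \<le> 1" using h
      by (simp add: power2_eq_square power3_eq_cube algebra_simps)
    moreover have "1 * 5 \<le> a\<^sup>2 * (2 * a - 1)" using assms by (intro mult_mono) auto
    ultimately show False using zero_le_power2[of "b - a"] by linarith
  next
    case 2
    define c where "c = - h"
    have c: "c \<ge> 1" "a\<^sup>2 = 2 * b + c" using 2 by (auto simp: c_def h_def)
    have ceq: "c * (b\<^sup>2 - 2 * a) = 2 * a * b - 1"
    proof -
      have "a ^ 3 = a * a\<^sup>2" by (simp add: eval_nat_numeral)
      also have "\<dots> = 2 * a * b + a * c" unfolding c(2) by (simp add: algebra_simps)
      finally have "c * b\<^sup>2 = 2 * a * b + 2 * (a * c) - 1" using h unfolding c_def by simp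
      moreover have "c * (b\<^sup>2 - 2 * a) = c * b\<^sup>2 - 2 * (a * c)" by (simp add: algebra_simps)
      ultimately show ?thesis by linarith
    qed
    \<comment> \<open>Equal parity gives a gap of 2, just enough for
      \<open>b^2 - 2 * a > a * b\<close>; then \<open>ceq\<close> leaves no room for
      \<open>c \<ge> 2\<close>.\<close>
    have "b \<ge> a + 2" using assms by presburger
    then have "b * b \<ge> (a + 2) * b" using assms by (intro mult_right_mono) auto
    then have lo: "b\<^sup>2 - 2 * a > a * b" using assms by (simp add: power2_eq_square algebra_simps)
    have "c < 2"
    proof (rule ccontr)
      assume "\<not> c < 2"
      moreover have "0 \<le> b\<^sup>2 - 2 * a" using lo assms by (smt (verit) mult_nonneg_nonneg)
      ultimately have "2 * (b\<^sup>2 - 2 * a) \<le> c * (b\<^sup>2 - 2 * a)" by (intro mult_right_mono) auto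
      then have "2 * (b\<^sup>2 - 2 * a) \<le> 2 * a * b - 1" by (simp only: ceq)
      then show False using lo by (simp add: algebra_simps)
    qed
    then have "a\<^sup>2 = 2 * b + 1" using c by simp
    moreover obtain i j where "a = 2 * i + 1" "b = 2 * j + 1" using assms by (meson oddE)
    ultimately have "4 * (i * i + i) = 4 * j + 2" by (simp add: power2_eq_square algebra_simps)
    then show False by presburger
  qed
qed

text \<open>The branch is \<open>a^4 ~ 8 * b\<close>, where \<open>h\<close> is about
  \<open>4 * a^3 / b\<close>, that is \<open>32 / a\<close>. As an odd fourth power is 1 modulo 8, a
  positive \<open>h\<close> is at least 7, so only \<open>a = 3\<close> escapes the size estimate; a
  negative \<open>h\<close> would need \<open>b\<close> too small.\<close>

lemma fifth_powers_sum_ne_fourth_power: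
  fixes a b :: int
  assumes "odd a" "odd b" "3 \<le> a" "a < b"
  shows "(a * b + 1) ^ 4 \<noteq> 8 * (a ^ 5 + b ^ 5)"
proof
  assume eq: "(a * b + 1) ^ 4 = 8 * (a ^ 5 + b ^ 5)"
  define h where "h = 8 * b - a ^ 4"
  have h: "h * b ^ 4 = 4 * a ^ 3 * b ^ 3 + 6 * a\<^sup>2 * b\<^sup>2 + 4 * a * b + 1 - 8 * a ^ 5"
    using eq unfolding h_def by (simp add: eval_nat_numeral algebra_simps)
  have "h mod 8 = 7"
  proof -
    have "a mod 8 = 1 \<or> a mod 8 = 3 \<or> a mod 8 = 5 \<or> a mod 8 = 7" using assms(1) by presburger
    then have "a ^ 4 mod 8 = 1" by (auto simp: power_mod[of a 8 4, symmetric])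
    then show ?thesis unfolding h_def by presburger
  qed
  then have "h \<ge> 7 \<or> h \<le> -1" by presburger
  then consider "h \<ge> 7" | "h \<le> -1" by blast
  then show False
  proof cases
    case 1
    have "7 * b ^ 4 \<le> h * b ^ 4" using 1 by (intro mult_right_mono) auto
    then have up: "7 * b ^ 4 \<le> 4 * a ^ 3 * b ^ 3 + 6 * a\<^sup>2 * b\<^sup>2 + 4 * a * b + 1 - 8 * a ^ 5"
      using h by simp
    have a4: "a ^ 4 + 7 \<le> 8 * b" using 1 by (simp add: h_def)
    show False
    proof (cases "a = 3")
      case True
      have "b \<ge> 11" using a4 True by simp
      show False
      \<comment> \<open>The difference of the two sides is positive at \<open>b = 11\<close> and
        negative from 13 on: expanded around 13, all its coefficients are negative.\<close>
      proof (cases "b = 11")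
        case True
        then show False using eq \<open>a = 3\<close> by simp
      next
        case False
        then have "b \<ge> 13" using \<open>b \<ge> 11\<close> assms(2) by presburger
        then have "b - 13 \<ge> 0" by simp
        moreover define t where "t = b - 13"
        ultimately have t: "t \<ge> 0" "b = t + 13" by simp_all
        have "t ^ 5 \<ge> 0" "t ^ 4 \<ge> 0" "t ^ 3 \<ge> 0" "t\<^sup>2 \<ge> 0" using t(1) by simp_all
        moreover have "(3 * b + 1) ^ 4 - 8 * (3 ^ 5 + b ^ 5) =
          - (8 * t ^ 5 + 439 * t ^ 4 + 9200 * t ^ 3 + 89360 * t\<^sup>2 + 374440 * t + 412288)"
          unfolding t(2) by (simp add: eval_nat_numeral algebra_simps)
        ultimately show False using eq t(1) unfolding \<open>a = 3\<close> by linarith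
      qed
    next
      case False
      then have "a \<ge> 5" using assms by presburger
      then have "25 \<le> a\<^sup>2" using power_mono[of 5 a 2] by simp
      then have "25 * 25 \<le> a\<^sup>2 * a\<^sup>2" by (intro mult_mono) auto
      moreover have "25 * a\<^sup>2 \<le> a\<^sup>2 * a\<^sup>2"
        using \<open>25 \<le> a\<^sup>2\<close> by (intro mult_right_mono) auto
      moreover have "5 * a ^ 3 \<le> a * a ^ 3" using \<open>a \<ge> 5\<close> by (intro mult_right_mono) auto
      moreover have "a * a ^ 3 = a ^ 4" "a\<^sup>2 * a\<^sup>2 = a ^ 4" by (simp_all add: eval_nat_numeral)
      ultimately have bounds: "5 * a ^ 3 \<le> 8 * b" "25 * a\<^sup>2 \<le> 8 * b" "b \<ge> 79"
        using a4 by simp_all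
      \<comment> \<open>The main term is now at most \<open>32/5 * b^4\<close>, below
        \<open>7 * b^4\<close>; \<open>b \<ge> 79\<close> absorbs the lower terms in the
        gap.\<close>
      have "5 * a ^ 3 * b ^ 3 \<le> 8 * b * b ^ 3" "25 * a\<^sup>2 * b\<^sup>2 \<le> 8 * b * b\<^sup>2" "a * b \<le> b * b"
        using bounds assms by (auto intro!: mult_right_mono)
      moreover have "79 * b ^ 3 \<le> b * b ^ 3" "79 * b\<^sup>2 \<le> b * b\<^sup>2" "79\<^sup>2 \<le> b\<^sup>2"
        using bounds power_mono[of 79 b 2] by (auto intro!: mult_right_mono)
      moreover have "0 \<le> a ^ 5" using assms by simp
      moreover have "b * b ^ 3 = b ^ 4" "b * b\<^sup>2 = b ^ 3" "b * b = b\<^sup>2" by (simp_all add: eval_nat_numeral)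
      ultimately show False using up by (simp add: mult.assoc)
    qed
  next
    case 2
    have "h * b ^ 4 \<le> - 1 * b ^ 4" using 2 by (intro mult_right_mono) auto
    moreover have "0 < a\<^sup>2 * b\<^sup>2" "0 < a * b" "0 < b ^ 4" "0 < a ^ 5" using assms by simp_all
    ultimately have "4 * (a ^ 3 * b ^ 3) < 8 * a ^ 5" "0 < a ^ 5"
      using h unfolding mult.assoc by linarith+
    moreover have "a ^ 3 * a ^ 3 \<le> a ^ 3 * b ^ 3" using assms by (intro mult_left_mono power_mono) auto
    moreover have "a ^ 3 * a ^ 3 = a ^ 5 * a" by (simp add: eval_nat_numeral)
    moreover have "a ^ 5 * 3 \<le> a ^ 5 * a" using assms by (intro mult_left_mono) auto
    ultimately show False by linarith
  qed
qed

text \<open>The bound on \<open>j\<close> means \<open>b \<le> 41\<close>, which on the curve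
  follows from \<open>4 * b^2 < a^3\<close> and \<open>a \<le> 19\<close>.\<close>

lemma fifth_powers_sum_ne_cube_le_19:
  "list_all (\<lambda>i. let a = 2 * i + 1 in list_all (\<lambda>j. let b = 2 * j + 1 in
     (a * b + 1) ^ 3 \<noteq> 4 * (a ^ 5 + b ^ 5)) [i + 1..20]) [1..9::int]"
  by code_simp

text \<open>Three Newton steps from the tangent line of the square root at a = 64 reach the only candidate
  s for b, the integer square root of n.\<close>

lemma fifth_powers_sum_ne_cube_le_123:
  "list_all (\<lambda>i. let a = 2 * i + 1; n = a ^ 3 div 4; 
      N = (\<lambda>s. (s + n div s) div 2); s = N (N (N (a * (a + 64) div 32))) in
      0 < s \<and> s\<^sup>2 \<le> n \<and> n < (s + 1)\<^sup>2 \<and> (a * s + 1) ^ 3 \<noteq> 4 * (a ^ 5 + s ^ 5)) [10..61::int]"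
  by code_simp

text \<open>Along the branch \<open>e\<close> and \<open>f\<close> already tend to 0, but slowly,
  like \<open>410 / sqrt a\<close> and a multiple of \<open>a^(-3/2)\<close>. The further remainder
  \<open>g\<close> decays like \<open>a^(-5/2)\<close> and drops below 1 early enough to leave a
  short range of \<open>a\<close> for computation.\<close>

lemma fifth_powers_sum_ne_cube:
  fixes a b :: int
  assumes "odd a" "odd b" "3 \<le> a" "a < b"
  shows "(a * b + 1) ^ 3 \<noteq> 4 * (a ^ 5 + b ^ 5)"
proof
  assume eq: "(a * b + 1) ^ 3 = 4 * (a ^ 5 + b ^ 5)"
  (* On the branch a^3 ~ 4 b^2 the leading terms of b h, b e, b f are 13 a^2, 205 a, 5983,
     and b f - 5983 = 4 g. *)
  define D where "D = b ^ 3 - 4 * a\<^sup>2"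
  define h where "h = a ^ 3 - 4 * b\<^sup>2"
  define e where "e = b * h - 13 * a\<^sup>2"
  define f where "f = b * e - 205 * a"
  define g where "g = a\<^sup>2 * h - 52 * a * b - 1496"
  have h: "h * D = 13 * a\<^sup>2 * b\<^sup>2 - 3 * a * b - 1"
    using eq unfolding h_def D_def by (simp add: eval_nat_numeral algebra_simps)
  \<comment> \<open>Multiplying each remainder by \<open>D\<close> and substituting the previous
    product gives polynomials whose sign and size can be read off.\<close>
  have "e * D = b * (h * D) - 13 * a\<^sup>2 * D" by (simp add: e_def algebra_simps)
  then have e: "e * D = 52 * a ^ 4 - 3 * a * b\<^sup>2 - b"
    unfolding h by (simp add: D_def eval_nat_numeral algebra_simps)
  have "f * D = b * (e * D) - 205 * a * D" by (simp add: f_def algebra_simps)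
  then have f: "f * D = 52 * a * b * h - b\<^sup>2 + 820 * a ^ 3"
    unfolding e by (simp add: D_def h_def eval_nat_numeral algebra_simps)
  \<comment> \<open>All coefficients on the right of \<open>g\<close> are positive, so
    \<open>e, f > 0\<close> yield \<open>g \<ge> 1\<close>, while \<open>D\<close> far outgrows
    \<open>a^2\<close>.\<close>
  have "4 * g * D = 4 * a\<^sup>2 * (h * D) - 208 * a * b * D - 5984 * D"
    by (simp add: g_def algebra_simps)
  then have g: "4 * g * D = 54040 * a\<^sup>2 + 1496 * e + 52 * a * f"
    unfolding h by (simp add: f_def e_def D_def h_def eval_nat_numeral algebra_simps)
  have ab: "a * a < a * b" "a * b < b * b" "3 * a \<le> a * a" using assms by auto
  have "b \<ge> 5" using assms by presburger
  then have "b\<^sup>2 * 4 < b\<^sup>2 * b" by simp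
  moreover have "b\<^sup>2 * b = b ^ 3" by (simp add: eval_nat_numeral algebra_simps)
  ultimately have "D > 0" using ab unfolding D_def power2_eq_square by linarith
  have "1 < a * b" "0 < a * b" using ab assms by linarith+
  moreover from this have "1 * (a * b) \<le> (a * b) * (a * b)" by (intro mult_right_mono) auto
  ultimately have "0 < h * D" unfolding h by (simp add: power2_eq_square mult_ac)
  then have "h > 0" using \<open>D > 0\<close> by (simp add: zero_less_mult_iff)
  then have b2: "4 * b\<^sup>2 < a ^ 3" by (simp add: h_def)
  have "a * (4 * b\<^sup>2) < a * a ^ 3" using b2 assms by simp
  moreover have "b * 1 \<le> b * b" "1 * b\<^sup>2 \<le> a * b\<^sup>2" using assms by (auto intro!: mult_left_mono mult_right_mono)
  moreover have "a * a ^ 3 = a ^ 4" by (simp add: eval_nat_numeral algebra_simps)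
  moreover have "0 < a ^ 4" using assms by simp
  ultimately have "0 < e * D" unfolding e power2_eq_square by linarith
  then have "e > 0" using \<open>D > 0\<close> by (simp add: zero_less_mult_iff)
  have "0 < f * D" unfolding f
    using b2 \<open>h > 0\<close> assms by (smt (verit) mult_pos_pos zero_less_power)
  then have "f > 0" using \<open>D > 0\<close> by (simp add: zero_less_mult_iff)
  have "0 < a * f" using assms \<open>f > 0\<close> by simp
  then have "0 < g * D" using g \<open>e > 0\<close> zero_le_power2[of a] by linarith
  then have "g \<ge> 1" using \<open>D > 0\<close> by (simp add: zero_less_mult_iff)
  show False
  proof (cases "a \<le> 19")
    case True
    obtain i j where ij: "a = 2 * i + 1" "b = 2 * j + 1" using assms by (meson oddE)
    have "a ^ 3 \<le> 19 ^ 3" using True assms by (intro power_mono) auto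
    then have "b\<^sup>2 < 42\<^sup>2" using b2 by simp
    then have "b < 42" by (rule power2_less_imp_less) simp
    then have "i \<in> {1..9}" "j \<in> {i + 1..20}" using ij assms True by auto
    then have "i \<in> set [1..9]" "j \<in> set [i + 1..20]" by (simp_all only: set_upto)
    then show False using fifth_powers_sum_ne_cube_le_19 eq unfolding list_all_iff Let_def ij by blast
  next
    case False
    then have "a \<ge> 21" using assms(1) by presburger
    \<comment> \<open>This confines the point to the branch \<open>a^3 ~ 4 * b^2\<close>: otherwise
      \<open>h > b^2\<close> makes \<open>D\<close> so small that \<open>b^3 < 17 * a^2\<close>,
      impossible for \<open>a \<ge> 21\<close> and \<open>b > a\<close>.\<close>
    have a3: "a ^ 3 \<le> 5 * b\<^sup>2"
    proof (rule ccontr)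
      assume "\<not> a ^ 3 \<le> 5 * b\<^sup>2"
      then have "b\<^sup>2 * D \<le> h * D" using \<open>D > 0\<close> by (intro mult_right_mono) (auto simp: h_def)
      also have "\<dots> < b\<^sup>2 * (13 * a\<^sup>2)" unfolding h using \<open>0 < a * b\<close> by (simp add: mult_ac)
      finally have "D < 13 * a\<^sup>2" using assms by simp
      then have "b ^ 3 < 17 * a\<^sup>2" by (simp add: D_def)
      moreover have "a ^ 3 \<le> b ^ 3" using assms by (intro power_mono) auto
      moreover have "17 * a\<^sup>2 \<le> a * a\<^sup>2" using \<open>a \<ge> 21\<close> by (intro mult_right_mono) auto
      moreover have "a * a\<^sup>2 = a ^ 3" by (simp add: eval_nat_numeral algebra_simps)
      ultimately show False by linarith
    qed
    show False
    proof (cases "a \<le> 123")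
      case True
      \<comment> \<open>The aim is \<open>h < 8 * b\<close>: together with \<open>h > 0\<close> it
        makes \<open>b\<close> the integer square root of \<open>a ^ 3 div 4\<close>, a single
        candidate for each \<open>a\<close>.\<close>
      have "b\<^sup>2 * e = 4 * a\<^sup>2 * h - 3 * a * b - 1"
        using h by (simp add: e_def D_def eval_nat_numeral algebra_simps)
      then have "b\<^sup>2 * e < 4 * a\<^sup>2 * h" using \<open>0 < a * b\<close> by linarith
      also have "\<dots> \<le> 4 * a\<^sup>2 * b\<^sup>2" using a3 by (intro mult_left_mono) (auto simp: h_def)
      finally have "e < 4 * a\<^sup>2" using assms by (simp add: mult.commute)
      have "h < 8 * b"
      proof (rule ccontr)
        assume "\<not> h < 8 * b"
        then have "b * (8 * b) \<le> b * h" using assms by (intro mult_left_mono) auto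
        then have "8 * b\<^sup>2 < 17 * a\<^sup>2" using \<open>e < 4 * a\<^sup>2\<close>
          by (simp add: e_def power2_eq_square)
        moreover have "21 * a\<^sup>2 \<le> a * a\<^sup>2" using \<open>a \<ge> 21\<close> by (intro mult_right_mono) auto
        moreover have "a * a\<^sup>2 = a ^ 3" by (simp add: eval_nat_numeral algebra_simps)
        ultimately show False using a3 assms by (smt (verit) zero_less_power)
      qed
      then have "a ^ 3 < 4 * (b + 1)\<^sup>2" by (simp add: h_def power2_eq_square algebra_simps)
      then have n: "b\<^sup>2 \<le> a ^ 3 div 4" "a ^ 3 div 4 < (b + 1)\<^sup>2"
        using b2 by linarith+
      obtain i where i: "a = 2 * i + 1" using assms by (meson oddE)
      then have "i \<in> {10..61}" using True \<open>a \<ge> 21\<close> by simp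
      then have "i \<in> set [10..61]" by (simp only: set_upto)
      then obtain s where s: "s > 0" "s\<^sup>2 \<le> a ^ 3 div 4" "a ^ 3 div 4 < (s + 1)\<^sup>2"
        "(a * s + 1) ^ 3 \<noteq> 4 * (a ^ 5 + s ^ 5)"
        using fifth_powers_sum_ne_cube_le_123 unfolding list_all_iff Let_def i by blast
      have "s < b + 1" using s n assms by (intro power2_less_imp_less[of s "b + 1"]) auto
      moreover have "b < s + 1" using s n by (intro power2_less_imp_less[of b "s + 1"]) auto
      ultimately show False using s eq by simp
    next
      case False
      then have "a \<ge> 125" using assms(1) by presburger
      \<comment> \<open>The threshold 125 = 5 * 5^2 turns \<open>a3\<close> into
        \<open>5 * a \<le> b\<close>, so \<open>D\<close> is nearly \<open>a^4\<close> or more. This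
        forces in turn \<open>e \<le> 52\<close>, \<open>f \<le> 12\<close> and
        \<open>g < 1\<close>.\<close>
      have "125 * a\<^sup>2 \<le> a * a\<^sup>2" using \<open>a \<ge> 125\<close> by (intro mult_right_mono) auto
      also have "a * a\<^sup>2 = a ^ 3" by (simp add: eval_nat_numeral algebra_simps)
      finally have "(5 * a)\<^sup>2 \<le> b\<^sup>2" using a3 by (simp add: power_mult_distrib)
      then have "5 * a \<le> b" by (rule power2_le_imp_le) (use assms in simp)
      then have "5 * a * a ^ 3 \<le> b * (5 * b\<^sup>2)" using a3 assms by (intro mult_mono) auto
      moreover have "5 * a * a ^ 3 = 5 * a ^ 4" "b * (5 * b\<^sup>2) = 5 * b ^ 3" by (simp_all add: eval_nat_numeral)
      ultimately have D: "a ^ 4 - 4 * a\<^sup>2 \<le> D" by (simp add: D_def)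
      have "125 * 125 \<le> a * a" using \<open>a \<ge> 125\<close> by (intro mult_mono) auto
      moreover from this have "15625 * a\<^sup>2 \<le> a\<^sup>2 * a\<^sup>2"
        by (intro mult_right_mono) (auto simp: power2_eq_square)
      moreover have "125 * a ^ 3 \<le> a * a ^ 3" "125 * a \<le> a * a"
        using \<open>a \<ge> 125\<close> by (auto intro!: mult_right_mono)
      moreover have "a\<^sup>2 * a\<^sup>2 = a ^ 4" "a * a ^ 3 = a ^ 4" "a * a = a\<^sup>2" by (simp_all add: eval_nat_numeral)
      ultimately have a: "15625 * a\<^sup>2 \<le> a ^ 4" "125 * a ^ 3 \<le> a ^ 4" "125 * a \<le> a\<^sup>2" "15625 \<le> a\<^sup>2"
        by simp_all
      have "e * D < 53 * D" using D a e assms by (smt (verit) mult_nonneg_nonneg zero_le_power)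
      then have "e \<le> 52" using \<open>D > 0\<close> by simp
      then have "a * e \<le> a * 52" using assms by (intro mult_left_mono) auto
      moreover have "52 * a * b * h = 676 * a ^ 3 + 52 * (a * e)" unfolding e_def by (simp add: eval_nat_numeral algebra_simps)
      ultimately have "f * D < 13 * D" using f D a \<open>a \<ge> 125\<close> zero_le_power2[of b] by linarith
      then have "f \<le> 12" using \<open>D > 0\<close> by simp
      then have "a * f \<le> a * 12" using assms by (intro mult_left_mono) auto
      then have "4 * g * D < 4 * D" using g D a \<open>e \<le> 52\<close> by linarith
      then show False using \<open>D > 0\<close> \<open>g \<ge> 1\<close> by simp
    qed
  qed
qed

section \<open>Sums of two y-th powers equal to twice a power of k\<close>

lemma pow_sum_ne_twice_pow_one:
  fixes k :: int
  assumes "k > 1" "y = 3 \<or> y = 5"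
  shows "1 + (2 * k - 1) ^ y \<noteq> 2 * k ^ w"
proof
  assume eq: "1 + (2 * k - 1) ^ y = 2 * k ^ w"
  \<comment> \<open>\<open>Q\<close> collects the binomial terms of degree at least 2 in
    \<open>k\<close>; the linear term, after halving, is \<open>y * k\<close>.\<close>
  obtain Q where "1 + (2 * k - 1) ^ y = 2 * (k\<^sup>2 * Q + int y * k)"
  proof (cases "y = 3")
    case True
    show thesis
      by (rule that[of "4 * k - 6"]) (simp add: True eval_nat_numeral algebra_simps)
  next
    case False
    then have "y = 5" using assms by simp
    show thesis
      by (rule that[of "16 * k ^ 3 - 40 * k\<^sup>2 + 40 * k - 20"])
        (simp add: \<open>y = 5\<close> eval_nat_numeral algebra_simps)
  qed
  then have Q: "k ^ w = k\<^sup>2 * Q + int y * k" using eq by simp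
  have "(2 * k - 1) ^ 2 \<le> (2 * k - 1) ^ y" using assms by (intro power_increasing) auto
  moreover have "(2 * k - 1) ^ 2 = 4 * (k * k) - 4 * k + 1"
    by (simp add: power2_eq_square algebra_simps)
  moreover have "2 * k \<le> k * k" using assms by (intro mult_right_mono) auto
  ultimately have "k ^ 1 < k ^ w" using eq assms(1) unfolding power_one_right by linarith
  then have "w \<ge> 2" using assms(1) power_strict_increasing_iff[of k 1 w] by simp
  then have "k\<^sup>2 dvd k ^ w" by (rule le_imp_power_dvd)
  then have "k\<^sup>2 dvd int y * k" unfolding Q by (metis dvd_add_right_iff dvd_triv_left)
  then have "k dvd int y" using assms(1) by (simp add: power2_eq_square)
  then have "k = int y"
  proof -
    have "k \<le> int y" using \<open>k dvd int y\<close> assms(2) by (auto dest: zdvd_imp_le)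
    then have "k \<in> {2, 3, 4, 5}" using assms by auto
    then show ?thesis using \<open>k dvd int y\<close> assms(2) by auto
  qed
  \<comment> \<open>With \<open>k = y\<close> the left side is 126 or 59050. It is not
    \<open>2 * k^2\<close>, and neither 54 divides 126 nor 250 divides 59050.\<close>
  consider "w = 2" | "w \<ge> 3" using \<open>w \<ge> 2\<close> by linarith
  then show False
  proof cases
    case 1
    then show False using eq assms(2) \<open>k = int y\<close> by auto
  next
    case 2
    then have "k ^ 3 dvd k ^ w" by (rule le_imp_power_dvd)
    then have "2 * k ^ 3 dvd 1 + (2 * k - 1) ^ y" unfolding eq by simp
    then show False using assms(2) \<open>k = int y\<close> by auto
  qed
qed

lemma pow_sum_ne_twice_pow:
  fixes a b k :: int
  assumes "odd a" "odd b" "0 < a" "a < b" "a * b + 1 = 2 * k" "y = 3 \<or> y = 5"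
  shows "a ^ y + b ^ y \<noteq> 2 * k ^ w"
proof
  assume eq: "a ^ y + b ^ y = 2 * k ^ w"
  show False
  proof (cases "a = 1")
    case True
    then have "b = 2 * k - 1" "k > 1" using assms by auto
    then show False using eq pow_sum_ne_twice_pow_one assms(6) True by simp
  next
    case False
    then have "a \<ge> 3" using assms(1,3) by presburger
    then have "3 * b \<le> a * b" using assms by (intro mult_right_mono) auto
    then have "b < k" using assms by linarith
    have "a ^ y < b ^ y" using assms by (intro power_strict_mono) auto
    then have "k ^ w < b ^ y" using eq by simp
    also have "\<dots> \<le> k ^ y" using \<open>b < k\<close> assms by (intro power_mono) auto
    finally have "w < y" using power_strict_increasing_iff[of k w y] \<open>b < k\<close> assms by simp
    have "(a + 1) * b \<le> b * b" using assms by (intro mult_right_mono) auto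
    then have kb: "2 * k \<le> b\<^sup>2" using assms by (simp add: power2_eq_square algebra_simps)
    \<comment> \<open>Since \<open>2 * k \<le> b^2\<close>, an exponent \<open>w \<le> n\<close>
      gives \<open>2 * k^w \<le> (2 * k)^n \<le> b^(2 * n)\<close>, too small against
      \<open>a^y + b^y\<close>.\<close>
    have low: False if "w \<le> n" "1 \<le> n" "2 * n < y" for n
    proof -
      have "k ^ w \<le> k ^ n" using that \<open>b < k\<close> assms by (intro power_increasing) auto
      moreover have "(2::int) ^ 1 \<le> 2 ^ n" using that by (intro power_increasing) auto
      ultimately have "2 * k ^ w \<le> 2 ^ n * k ^ n"
        using \<open>b < k\<close> assms by (intro mult_mono) auto
      also have "\<dots> = (2 * k) ^ n" by (simp add: power_mult_distrib)
      also have "\<dots> \<le> (b\<^sup>2) ^ n" using kb \<open>b < k\<close> assms by (intro power_mono) auto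
      also have "\<dots> = b ^ (2 * n)" by (simp add: power_mult)
      also have "\<dots> \<le> b ^ y" using that assms by (intro power_increasing) auto
      finally have "2 * k ^ w \<le> b ^ y" .
      moreover have "0 < a ^ y" using assms by simp
      ultimately show False using eq by linarith
    qed
    have "w = 2 \<and> y = 3 \<or> w = 3 \<and> y = 5 \<or> w = 4 \<and> y = 5"
    proof -
      have "\<not> w \<le> 1" using low[of 1] assms(6) by auto
      moreover have "y = 5 \<longrightarrow> \<not> w \<le> 2" using low[of 2] by auto
      ultimately show ?thesis using assms(6) \<open>w < y\<close> by linarith
    qed
    \<comment> \<open>Multiplying \<open>eq\<close> by \<open>2^(w - 1)\<close> and replacing
      \<open>2 * k\<close> by \<open>a * b + 1\<close> gives the three curves.\<close>
    then show False
    proof (elim disjE conjE)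
      assume "w = 2" "y = 3"
      then show False using cubes_sum_ne_square[of a b] assms \<open>a \<ge> 3\<close> eq by simp
    next
      assume "w = 3" "y = 5"
      then show False using fifth_powers_sum_ne_cube[of a b] assms \<open>a \<ge> 3\<close> eq
        by (simp add: power_mult_distrib)
    next
      assume "w = 4" "y = 5"
      then show False using fifth_powers_sum_ne_fourth_power[of a b] assms \<open>a \<ge> 3\<close> eq
        by (simp add: power_mult_distrib)
    qed
  qed
qed

section \<open>Parity of z and the difference of squares\<close>

theorem theorem1p1:
  fixes k :: int
  assumes "k > 1"
    and "\<exists>d::int. d > 0 \<and> d dvd 2 * k - 1 \<and> ([d = 3] (mod 8) \<or> [d = -3] (mod 8))"
  shows "\<not> (\<exists>(x::int) (y::nat) (z::nat). x > 0 \<and> y > 0 \<and> z > 0 \<and> y \<in> {3, 5} \<and>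
            x ^ 2 + (2 * k - 1) ^ y = k ^ z)"
proof
  assume "\<exists>(x::int) (y::nat) (z::nat). x > 0 \<and> y > 0 \<and> z > 0 \<and> y \<in> {3, 5} \<and>
            x ^ 2 + (2 * k - 1) ^ y = k ^ z"
  then obtain x :: int and y z :: nat where x: "x > 0" and y: "y = 3 \<or> y = 5"
    and eq: "x\<^sup>2 + (2 * k - 1) ^ y = k ^ z" by auto
  obtain d :: int where d: "d > 0" "d dvd 2 * k - 1" "[d = 3] (mod 8) \<or> [d = -3] (mod 8)"
    using assms(2) by blast
  have "even z"
  proof (rule ccontr)
    assume "odd z"
    then obtain t where z: "z = 2 * t + 1" by (elim oddE)
    \<comment> \<open>Modulo \<open>d\<close> one has \<open>2 * k = 1\<close>, so multiplying the
      equation by \<open>2^z\<close> gives \<open>2^z * x^2 = 1\<close>. For odd \<open>z\<close>,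
      doubling turns the left side into a square congruent to 2.\<close>
    have sq: "(2 ^ (t + 1) * x)\<^sup>2 = 2 * (2 ^ z * x\<^sup>2)"
      unfolding z by (simp add: power_mult_distrib power_even_eq)
    have "d dvd (2 * k - 1) ^ y" using dvd_trans[OF d(2) dvd_power[of y]] y by auto
    also have "(2 * k - 1) ^ y = k ^ z - x\<^sup>2" using eq by simp
    finally have "d dvd 2 ^ z * (k ^ z - x\<^sup>2)" by simp
    moreover have "[(2 * k) ^ z = 1 ^ z] (mod d)"
      by (rule cong_pow) (use d(2) in \<open>simp add: cong_iff_dvd_diff\<close>)
    then have "d dvd (2 * k) ^ z - 1" by (simp add: cong_iff_dvd_diff)
    ultimately have "d dvd (2 * k) ^ z - 1 - 2 ^ z * (k ^ z - x\<^sup>2)"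
      by (rule dvd_diff[rotated])
    then have "d dvd 2 * ((2 * k) ^ z - 1 - 2 ^ z * (k ^ z - x\<^sup>2))"
      by (rule dvd_mult)
    also have "\<dots> = (2 ^ (t + 1) * x)\<^sup>2 - 2"
      unfolding sq by (simp add: power_mult_distrib right_diff_distrib)
    finally show False using two_not_square_mod[OF d(1,3)] by blast
  qed
  then obtain w where w: "z = 2 * w" by (elim evenE)
  define u where "u = k ^ w - x"
  define v where "v = k ^ w + x"
  have uv: "u * v = (2 * k - 1) ^ y"
    using eq by (simp add: u_def v_def w power_mult power2_eq_square algebra_simps flip: power_add)
  have "v > 0" using x assms(1) by (simp add: v_def add_pos_pos)
  have "(2 * k - 1) ^ y > 0" using assms(1) by simp
  then have "u > 0" using \<open>v > 0\<close> uv by (metis zero_less_mult_pos2)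
  have "coprime u v"
  proof (rule coprimeI)
    fix c assume "c dvd u" "c dvd v"
    \<comment> \<open>The sum \<open>2 * k^w\<close> and the product \<open>(2 * k - 1)^y\<close>
      are coprime: the latter is odd, and \<open>2 * k - 1\<close> is -1 modulo
      \<open>k\<close>.\<close>
    then have "c dvd u + v" "c dvd u * v" by auto
    then have "c dvd 2 * k ^ w" "c dvd (2 * k - 1) ^ y" by (simp_all add: uv) (simp add: u_def v_def)
    moreover have "coprime k (2 * k - 1)"
    proof (rule coprimeI)
      fix c assume "c dvd k" "c dvd 2 * k - 1"
      then have "c dvd 2 * k - (2 * k - 1)" by (rule dvd_diff[OF dvd_mult])
      then show "is_unit c" by simp
    qed
    then have "coprime (2 * k ^ w) ((2 * k - 1) ^ y)" by simp
    ultimately show "is_unit c" by (meson coprime_common_divisor)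
  qed
  moreover have "2 * k - 1 > 0" "y > 0" using assms(1) y by auto
  ultimately obtain a b where
    ab: "a > 0" "b > 0" "u = a ^ y" "v = b ^ y" "a * b = 2 * k - 1"
    using coprime_mult_eq_powerE_int[OF _ \<open>u > 0\<close> \<open>v > 0\<close> _ _ uv] by blast
  have "a ^ y < b ^ y" using ab x by (simp add: u_def v_def)
  then have "a < b" using ab by (simp add: power_less_imp_less_base)
  have "odd (a * b)" using ab by simp
  then have "odd a" "odd b" by auto
  moreover have "a ^ y + b ^ y = 2 * k ^ w" using ab by (simp add: u_def v_def)
  ultimately show False using pow_sum_ne_twice_pow[of a b k y w] ab \<open>a < b\<close> y by simp
qed

end
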